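(* Let $k \ge 1$ be an integer and let $S$ be a set of $n$ points in the plane in convex position. Let $d_1 > d_2 > \dotsb$ be the distinct distances between pairs of points of $S$, and let $m_i$ be the number of (unordered) pairs of points of $S$ at distance exactly $d_i$. Then $$m_{\le k} := \sum_{i=1}^{k} m_i \le (2k-1)n.$$
   Context: A finite set of points in the plane is in convex position if every point of the set is a vertex of its convex hull, i.e. the points are exactly the vertices of a convex polygon. Convention: $m_i = 0$ if there are fewer than $i$ distinct distances. *)

theory Defs
  imports "HOL-Analysis.Analysis"
begin

definition convex_position :: "(real^2) set \<Rightarrow> bool" where
  "convex_position S \<longleftrightarrow> finite S \<and> (\<forall>p\<in>S. p extreme_point_of (convex hull S))"

definition distances :: "(real^2) set \<Rightarrow> real set" where
  "distances S = {dist p q | p q. p \<in> S \<and> q \<in> S \<and> p \<noteq> q}"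

text \<open>For finite S and 1 \<open>\<le>\<close> i \<open>\<le>\<close> \<open>card (distances S)\<close>, this is the i-th largest distance,
  counted from 1; the value for other i carries no meaning.\<close>

definition nth_distance :: "(real^2) set \<Rightarrow> nat \<Rightarrow> real" where
  "nth_distance S i = rev (sorted_list_of_set (distances S)) ! (i - 1)"

definition pairs_at_distance :: "(real^2) set \<Rightarrow> real \<Rightarrow> (real^2) set set" where
  "pairs_at_distance S d = {{p, q} | p q. p \<in> S \<and> q \<in> S \<and> p \<noteq> q \<and> dist p q = d}"

definition mult_dist :: "(real^2) set \<Rightarrow> nat \<Rightarrow> nat" where
  "mult_dist S i =
    (if 1 \<le> i \<and> i \<le> card (distances S) then card (pairs_at_distance S (nth_distance S i)) else 0)"

end

theory Submission
  imports Defs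
begin

text \<open>
  Number the points of \<open>S\<close> counterclockwise as \<open>P 0, \<dots>, P (n - 1)\<close> and read indices
  modulo \<open>n\<close>. As in a regular polygon, the chords fall into \<open>n\<close> classes of "parallel" chords,
  the class of \<open>P a P b\<close> being \<open>a + b\<close> modulo \<open>n\<close>. It suffices that each class contains at
  most \<open>2 k - 1\<close> chords whose length is among the \<open>k\<close> largest distances
  (\<open>parallel_class_card_le\<close>).

  Suppose that a class contains \<open>2 k\<close> such chords. They are the rungs \<open>A t B t\<close>, for \<open>t < 2 k\<close>,
  of a ladder: \<open>A 0, \<dots>, A (2 k - 1), B (2 k - 1), \<dots>, B 0\<close> appear counterclockwise in
  this order. Start from the last rung and move one end of the chord one rung backwards, in such a
  way that the chord becomes strictly longer; repeat. Since all chords visited are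
  at least as long as a rung, \<open>k\<close> such moves would exhibit \<open>k + 1\<close> different lengths among
  the \<open>k\<close> largest distances (\<open>increasing_walk_blocked\<close>). Hence this walk is blocked after fewer than
  \<open>k\<close> moves, at a chord with both ends in the second half of the ladder. For the same reason the walk
  from the first rung forwards is blocked at a chord with both ends in the first half. A chord at
  which no move makes it longer forms acute angles with the two sides leading to the other chord.
  So the two blocked chords span a convex quadrilateral with four acute angles, which is impossible
  because the angles add up to \<open>2 \<pi>\<close> (\<open>no_convex_quadrilateral_with_four_acute_angles\<close>).
\<close>

section \<open>Orientation in the plane\<close>

definition cross2 :: "real^2 \<Rightarrow> real^2 \<Rightarrow> real" where
  "cross2 v w = v$1 * w$2 - v$2 * w$1"

definition ccw :: "real^2 \<Rightarrow> real^2 \<Rightarrow> real^2 \<Rightarrow> bool" where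
  "ccw p q r \<longleftrightarrow> cross2 (q - p) (r - p) > 0"

lemma inner_real2: "v \<bullet> w = v$1 * w$1 + v$2 * w$2" for v w :: "real^2"
  by (simp add: inner_vec_def sum_2)

lemma vec2_eq_iff: "v = w \<longleftrightarrow> v$1 = w$1 \<and> v$2 = w$2" for v w :: "real^2"
  by (simp add: vec_eq_iff forall_2)

lemma ccw_rotate: "ccw p q r \<Longrightarrow> ccw q r p"
  by (simp add: ccw_def cross2_def algebra_simps)

lemma ccw_imp_distinct: "ccw p q r \<Longrightarrow> p \<noteq> q \<and> q \<noteq> r \<and> p \<noteq> r"
  by (auto simp: ccw_def cross2_def)

section \<open>Acute angles\<close>

text \<open>The side opposite to an angle that is right or obtuse is the longest one.\<close>

lemma acute_if_opposite_side_le: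
  fixes w v o' :: "real^2"
  assumes "dist w v \<le> dist o' v" "w \<noteq> o'"
  shows "(w - o') \<bullet> (v - o') > 0"
proof -
  have "(dist w v)\<^sup>2 \<le> (dist o' v)\<^sup>2"
    using assms(1) by (simp add: power_mono)
  moreover have "(dist w v)\<^sup>2 = (w - o') \<bullet> (w - o') - 2 * ((w - o') \<bullet> (v - o')) + (dist o' v)\<^sup>2"
    by (simp add: dist_norm power2_norm_eq_inner inner_real2 algebra_simps)
  moreover have "(w - o') \<bullet> (w - o') > 0"
    using assms(2) by simp
  ultimately show ?thesis by linarith
qed

text \<open>The products of signs express that the ray \<open>u\<close> lies between the rays \<open>v\<close> and \<open>w\<close>, in
  either orientation, so that its angle with \<open>v\<close> is at most that of \<open>w\<close>.\<close>

lemma acute_if_between: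
  fixes u v w :: "real^2"
  assumes uv: "cross2 v u * cross2 v w > 0" and uw: "cross2 u w * cross2 v w \<ge> 0"
    and acute: "w \<bullet> v > 0"
  shows "u \<bullet> v > 0"
proof -
  let ?c = "cross2 v w"
  have "(u \<bullet> v) * ?c = (v \<bullet> v) * cross2 u w + (w \<bullet> v) * cross2 v u"
    by (simp add: inner_real2 cross2_def algebra_simps)
  then have "(u \<bullet> v) * (?c * ?c) = (v \<bullet> v) * (cross2 u w * ?c) + (w \<bullet> v) * (cross2 v u * ?c)"
    by (metis (no_types, lifting) distrib_right mult.assoc)
  moreover have "(v \<bullet> v) * (cross2 u w * ?c) \<ge> 0"
    using uw by simp
  moreover have "(w \<bullet> v) * (cross2 v u * ?c) > 0"
    using uv acute by simp
  ultimately have "(u \<bullet> v) * (?c * ?c) > 0"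
    by linarith
  then show ?thesis
    by (metis zero_less_mult_pos2 not_real_square_gt_zero mult_zero_right less_irrefl)
qed

text \<open>If all four exterior angles exceeded a right angle, the boundary would turn by more
  than a full turn. In coordinates in which \<open>e1\<close> points to the right, \<open>e2\<close> must point up and to the left and
  \<open>e4\<close> down and to the left; no direction is left for \<open>e3\<close>.\<close>

lemma no_convex_quadrilateral_with_four_acute_angles:
  fixes e1 e2 e3 e4 :: "real^2"
  assumes c: "cross2 e1 e2 > 0" "cross2 e2 e3 > 0" "cross2 e3 e4 > 0" "cross2 e4 e1 > 0"
    and d: "e1 \<bullet> e2 < 0" "e2 \<bullet> e3 < 0" "e3 \<bullet> e4 < 0" "e4 \<bullet> e1 < 0"
  shows False
proof -
  let ?N = "e1 \<bullet> e1"
  have pos: "?N > 0"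
    using c(1) by (auto simp: cross2_def)
  \<comment> \<open>Up to the factor \<open>?N\<close>, these compute in the frame given by \<open>e1\<close> and its normal.\<close>
  have frame_cross: "?N * cross2 v w = (e1 \<bullet> v) * cross2 e1 w - cross2 e1 v * (e1 \<bullet> w)"
    and frame_inner: "?N * (v \<bullet> w) = (e1 \<bullet> v) * (e1 \<bullet> w) + cross2 e1 v * cross2 e1 w" for v w
    by (simp_all add: inner_real2 cross2_def algebra_simps)
  have s: "e1 \<bullet> e4 < 0" "cross2 e1 e4 < 0"
    using d(4) c(4) by (simp_all add: inner_commute cross2_def algebra_simps)
  have c23: "(e1 \<bullet> e2) * cross2 e1 e3 - cross2 e1 e2 * (e1 \<bullet> e3) > 0"
    using mult_pos_pos[OF pos c(2)] by (simp add: frame_cross)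
  have c34: "(e1 \<bullet> e3) * cross2 e1 e4 - cross2 e1 e3 * (e1 \<bullet> e4) > 0"
    using mult_pos_pos[OF pos c(3)] by (simp add: frame_cross)
  have d23: "(e1 \<bullet> e2) * (e1 \<bullet> e3) + cross2 e1 e2 * cross2 e1 e3 < 0"
    using mult_pos_neg[OF pos d(2)] by (simp add: frame_inner)
  have d34: "(e1 \<bullet> e3) * (e1 \<bullet> e4) + cross2 e1 e3 * cross2 e1 e4 < 0"
    using mult_pos_neg[OF pos d(3)] by (simp add: frame_inner)
  show False
  proof (cases "e1 \<bullet> e3 \<ge> 0")
    case True
    then have "cross2 e1 e2 * (e1 \<bullet> e3) \<ge> 0" "(e1 \<bullet> e3) * cross2 e1 e4 \<le> 0"
      using c(1) s(2) by (simp_all add: mult_nonneg_nonpos)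
    then have "(e1 \<bullet> e2) * cross2 e1 e3 > 0" "cross2 e1 e3 * (e1 \<bullet> e4) < 0"
      using c23 c34 by linarith+
    then show False
      using d(1) s(1) by (auto simp: zero_less_mult_iff mult_less_0_iff)
  next
    case False
    then have "(e1 \<bullet> e2) * (e1 \<bullet> e3) > 0" "(e1 \<bullet> e3) * (e1 \<bullet> e4) > 0"
      using d(1) s(1) by (simp_all add: mult_neg_neg)
    then have "cross2 e1 e2 * cross2 e1 e3 < 0" "cross2 e1 e3 * cross2 e1 e4 < 0"
      using d23 d34 by linarith+
    then show False
      using c(1) s(2) by (auto simp: mult_less_0_iff)
  qed
qed

section \<open>The counterclockwise order of points in convex position\<close>

lemma convex_position_not_in_triangle:
  assumes "convex_position S" "p \<in> S" "q \<in> S" "r \<in> S" "s \<in> S" "s \<noteq> p" "s \<noteq> q" "s \<noteq> r"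
    and "s = \<alpha> *\<^sub>R p + \<beta> *\<^sub>R q + \<gamma> *\<^sub>R r" "\<alpha> \<ge> 0" "\<beta> \<ge> 0" "\<gamma> \<ge> 0" "\<alpha> + \<beta> + \<gamma> = 1"
  shows False
proof -
  have "s extreme_point_of (convex hull S)"
    using assms by (auto simp: convex_position_def)
  then have "convex (convex hull S - {s})"
    by (simp add: extreme_point_of_stillconvex)
  moreover have "{p, q, r} \<subseteq> convex hull S - {s}"
    using assms hull_subset[of S convex] by auto
  ultimately have "convex hull {p, q, r} \<subseteq> convex hull S - {s}"
    by (simp add: hull_minimal)
  moreover have "s \<in> convex hull {p, q, r}"
    unfolding convex_hull_3 using assms(9-13) by blast
  ultimately show False by blast
qed

text \<open>As seen from the point \<open>p\<close> of largest norm, all other points lie in an open half-plane, so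
  their directions are linearly ordered, and counterclockwise order is the order of \<open>key\<close>, the
  tangents of their angles with the direction \<open>- p\<close>. Two equal keys would put one of the points on the segment from \<open>p\<close> to the
  other. That triangles not involving \<open>p\<close> are counterclockwise, too, is the remaining part of
  convexity: otherwise the middle point would lie in the triangle of \<open>p\<close> and the other two.\<close>

lemma convex_position_ccw_enumeration:
  assumes conv: "convex_position S"
  obtains P :: "nat \<Rightarrow> real^2" where "P ` {..<card S} = S"
    "\<And>i j l. i < j \<Longrightarrow> j < l \<Longrightarrow> l < card S \<Longrightarrow> ccw (P i) (P j) (P l)"
proof (cases "S = {}")
  case True
  then show ?thesis using that by simp
next
  case False
  have fin: "finite S" using conv by (simp add: convex_position_def)
  have "Max (norm ` S) \<in> norm ` S"
    using fin False by simp
  then obtain p where p: "p \<in> S" "norm p = Max (norm ` S)" by auto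
  have pmax: "norm q \<le> norm p" if "q \<in> S" for q
    using that fin p(2) by simp
  define depth where "depth q = p \<bullet> (p - q)" for q
  define key where "key q = cross2 (q - p) p / depth q" for q
  define S' where "S' = S - {p}"
  have depth_pos: "depth q > 0" if "q \<in> S'" for q
  proof -
    have "q \<noteq> p" "norm q \<le> norm p" using that pmax by (auto simp: S'_def)
    then have "(norm q)\<^sup>2 \<le> (norm p)\<^sup>2" "(norm (p - q))\<^sup>2 > 0"
      by (simp_all add: power_mono)
    moreover have "(norm (p - q))\<^sup>2 = 2 * depth q + (norm q)\<^sup>2 - (norm p)\<^sup>2"
      by (simp add: depth_def power2_norm_eq_inner inner_diff inner_commute)
    ultimately show ?thesis by linarith
  qed
  have pp: "p \<bullet> p > 0" if "q \<in> S'" for q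
    using depth_pos[OF that] by (auto simp: depth_def)
  have cross_key: "(p \<bullet> p) * cross2 (q - p) (r - p) = depth q * depth r * (key r - key q)"
    if "q \<in> S'" "r \<in> S'" for q r
  proof -
    have "(p \<bullet> p) * cross2 (q - p) (r - p)
        = depth q * cross2 (r - p) p - depth r * cross2 (q - p) p"
      by (simp add: depth_def inner_real2 cross2_def algebra_simps)
    also have "\<dots> = depth q * depth r * (key r - key q)"
      using depth_pos[OF that(1)] depth_pos[OF that(2)] by (simp add: key_def field_simps)
    finally show ?thesis .
  qed
  have inj_aux: False
    if qr: "q \<in> S'" "r \<in> S'" "q \<noteq> r" "key q = key r" "depth q \<le> depth r" for q r
  proof -
    have "cross2 (q - p) (r - p) = 0"
      using cross_key[OF qr(1,2)] qr(4) pp[OF qr(1)] by simp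
    then have c: "(q$1 - p$1) * (r$2 - p$2) = (q$2 - p$2) * (r$1 - p$1)"
      by (simp add: cross2_def)
    define t where "t = depth q / depth r"
    have t: "0 \<le> t" "t \<le> 1"
      using qr(5) depth_pos[OF qr(1)] depth_pos[OF qr(2)] by (simp_all add: t_def)
    have "depth r * (q$1 - p$1) - depth q * (r$1 - p$1)
        = - p$2 * ((q$1 - p$1) * (r$2 - p$2) - (q$2 - p$2) * (r$1 - p$1))"
      "depth r * (q$2 - p$2) - depth q * (r$2 - p$2)
        = p$1 * ((q$1 - p$1) * (r$2 - p$2) - (q$2 - p$2) * (r$1 - p$1))"
      by (simp_all add: depth_def inner_real2 algebra_simps)
    then have "depth r * (q$1 - p$1) = depth q * (r$1 - p$1)"
      "depth r * (q$2 - p$2) = depth q * (r$2 - p$2)"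
      using c by simp_all
    then have "q$1 - p$1 = t * (r$1 - p$1)" "q$2 - p$2 = t * (r$2 - p$2)"
      using depth_pos[OF qr(2)] by (simp_all add: t_def field_simps)
    then have "q = (1 - t) *\<^sub>R p + t *\<^sub>R r + 0 *\<^sub>R r"
      by (simp add: vec2_eq_iff algebra_simps)
    then show False
      using convex_position_not_in_triangle[OF conv, of p r r q "1 - t" t 0] t qr p(1)
      by (auto simp: S'_def)
  qed
  have inj: "inj_on key S'"
  proof (rule inj_onI, rule ccontr)
    fix q r assume "q \<in> S'" "r \<in> S'" "key q = key r" "q \<noteq> r"
    then show False
      using inj_aux[of q r] inj_aux[of r q] by (cases "depth q \<le> depth r") auto
  qed
  define ks where "ks = sorted_list_of_set (key ` S')"
  define P where "P i = (if i = 0 then p else inv_into S' key (ks ! (i - 1)))" for i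
  have finS': "finite S'" and cardS: "card S = Suc (card S')"
    using fin p(1) card.remove[of S p] by (simp_all add: S'_def)
  have len: "length ks = card S'"
    using inj finS' by (simp add: ks_def card_image)
  have set_ks: "set ks = key ` S'"
    using finS' by (simp add: ks_def)
  have P_in: "P i \<in> S'" and key_P: "key (P i) = ks ! (i - 1)" if "0 < i" "i < card S" for i
  proof -
    have "ks ! (i - 1) \<in> key ` S'"
      using that len cardS set_ks by (metis Suc_less_eq Suc_pred' nth_mem)
    then show "P i \<in> S'" "key (P i) = ks ! (i - 1)"
      using that by (simp_all add: P_def inv_into_into f_inv_into_f)
  qed
  have key_mono: "key (P i) < key (P j)" if "0 < i" "i < j" "j < card S" for i j
  proof -
    have "sorted_wrt (<) ks" by (simp add: ks_def)
    moreover have "i - 1 < j - 1" "j - 1 < length ks" using that len cardS by auto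
    ultimately have "ks ! (i - 1) < ks ! (j - 1)"
      by (rule sorted_wrt_nth_less)
    then show ?thesis using that by (simp add: key_P)
  qed
  have ccw_p: "ccw p (P i) (P j)" if "0 < i" "i < j" "j < card S" for i j
  proof -
    have i: "P i \<in> S'" and j: "P j \<in> S'" using P_in that by auto
    have "depth (P i) * depth (P j) * (key (P j) - key (P i)) > 0"
      using depth_pos[OF i] depth_pos[OF j] key_mono[OF that] by simp
    then have "(p \<bullet> p) * cross2 (P i - p) (P j - p) > 0"
      by (simp only: cross_key[OF i j])
    then show ?thesis
      unfolding ccw_def using pp[OF i] by (rule zero_less_mult_pos)
  qed
  have ccw_P: "ccw (P i) (P j) (P l)" if "i < j" "j < l" "l < card S" for i j l
  proof (cases "i = 0")
    case True
    then show ?thesis using ccw_p[of j l] that by (simp add: P_def)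
  next
    case False
    define A where "A = cross2 (P i - p) (P j - p)"
    define B where "B = cross2 (P j - p) (P l - p)"
    define C where "C = cross2 (P i - p) (P l - p)"
    define D where "D = cross2 (P j - P i) (P l - P i)"
    have pos: "A > 0" "B > 0" "C > 0"
      using ccw_p[of i j] ccw_p[of j l] ccw_p[of i l] that False
      by (auto simp: ccw_def A_def B_def C_def)
    show ?thesis
    proof (rule ccontr)
      assume "\<not> ccw (P i) (P j) (P l)"
      then have D: "D \<le> 0" by (simp add: ccw_def D_def)
      have sum: "- D + B + A = C"
        by (simp add: A_def B_def C_def D_def cross2_def algebra_simps)
      \<comment> \<open>Cramer's rule: the barycentric coordinates of \<open>P j\<close> are ratios of areas.\<close>
      have "C * (P j $ 1) = - D * p$1 + B * (P i $ 1) + A * (P l $ 1)"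
        "C * (P j $ 2) = - D * p$2 + B * (P i $ 2) + A * (P l $ 2)"
        by (simp_all add: A_def B_def C_def D_def cross2_def algebra_simps)
      then have "P j $ 1 = (- D * p$1 + B * (P i $ 1) + A * (P l $ 1)) / C"
        "P j $ 2 = (- D * p$2 + B * (P i $ 2) + A * (P l $ 2)) / C"
        using pos by (simp_all add: eq_divide_eq mult.commute)
      then have bary: "P j = (- D / C) *\<^sub>R p + (B / C) *\<^sub>R P i + (A / C) *\<^sub>R P l"
        by (simp add: vec2_eq_iff add_divide_distrib diff_divide_distrib)
      have inS: "P i \<in> S" "P j \<in> S" "P l \<in> S" and neq: "P j \<noteq> p"
        using P_in that False by (auto simp: S'_def)
      have neq': "P j \<noteq> P i" "P j \<noteq> P l"
        using key_mono[of i j] key_mono[of j l] that False by auto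
      have "- D / C \<ge> 0" "B / C \<ge> 0" "A / C \<ge> 0" "- D / C + B / C + A / C = 1"
        using pos D sum by (simp_all add: divide_nonpos_pos flip: add_divide_distrib diff_divide_distrib)
      then show False
        using convex_position_not_in_triangle[OF conv p(1) inS(1,3,2) neq neq' bary] by blast
    qed
  qed
  have "P ` {..<card S} = S"
  proof
    show "P ` {..<card S} \<subseteq> S"
      using P_in p(1) by (force simp: P_def S'_def)
    show "S \<subseteq> P ` {..<card S}"
    proof
      fix q assume "q \<in> S"
      show "q \<in> P ` {..<card S}"
      proof (cases "q = p")
        case True
        then show ?thesis using cardS by (auto simp: P_def intro!: image_eqI[of _ _ 0])
      next
        case False
        then have q: "q \<in> S'" using \<open>q \<in> S\<close> by (simp add: S'_def)
        then obtain t where t: "t < length ks" "ks ! t = key q"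
          using set_ks by (metis imageI in_set_conv_nth)
        then have "P (Suc t) = q"
          using q inj by (simp add: P_def)
        then show ?thesis using t len cardS by force
      qed
    qed
  qed
  then show ?thesis using that ccw_P by blast
qed

text \<open>Reading indices modulo \<open>n\<close> makes every window of \<open>n\<close> consecutive indices a counterclockwise
  enumeration.\<close>

lemma convex_position_cyclic_enumeration:
  assumes conv: "convex_position S" and n: "n = card S"
  obtains P :: "nat \<Rightarrow> real^2" where "P ` {..<n} = S" "\<And>i. P (i + n) = P i"
    "\<And>i j l. i < j \<Longrightarrow> j < l \<Longrightarrow> l < i + n \<Longrightarrow> ccw (P i) (P j) (P l)"
proof -
  obtain R where R: "R ` {..<n} = S"
    "\<And>i j l. i < j \<Longrightarrow> j < l \<Longrightarrow> l < n \<Longrightarrow> ccw (R i) (R j) (R l)"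
    using convex_position_ccw_enumeration[OF conv] n by metis
  define P where "P i = R (i mod n)" for i
  have "ccw (P i) (P j) (P l)" if ijl: "i < j" "j < l" "l < i + n" for i j l
  proof -
    define r m where "r = i mod n" and "m = i - i mod n"
    define s t where "s = j - m" and "t = l - m"
    have i: "i = m + r" by (simp add: r_def m_def)
    have j: "j = m + s" and l: "l = m + t"
      using ijl i by (simp_all add: s_def t_def)
    have st: "r < s" "s < t" "t < r + n"
      using ijl unfolding i j l by simp_all
    have r: "r < n" using ijl by (simp add: r_def)
    have "n dvd m" unfolding m_def by (rule dvd_minus_mod)
    then have P_eq: "P (m + x) = (if x < n then R x else R (x - n))" if "x < 2 * n" for x
    proof -
      have "(m + x) mod n = x mod n" using \<open>n dvd m\<close> by (metis dvdE mod_mult_self4)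
      also have "\<dots> = (if x < n then x else x - n)" using that by (simp add: le_mod_geq)
      finally show ?thesis by (simp add: P_def)
    qed
    have "s < 2 * n" "t < 2 * n" using st r by linarith+
    then have Pi: "P i = R r" and Pj: "P j = (if s < n then R s else R (s - n))"
      and Pl: "P l = (if t < n then R t else R (t - n))"
      unfolding i j l using P_eq[of r] P_eq[of s] P_eq[of t] r by simp_all
    consider "t < n" | "s < n" "n \<le> t" | "n \<le> s" by linarith
    then show ?thesis
    proof cases
      case 1
      then show ?thesis using R(2)[of r s t] Pi Pj Pl st by simp
    next
      case 2
      then have "ccw (R (t - n)) (R r) (R s)" using R(2)[of "t - n" r s] st by linarith
      then show ?thesis using 2 Pi Pj Pl by (simp add: ccw_rotate)
    next
      case 3
      then have "ccw (R (s - n)) (R (t - n)) (R r)" using R(2)[of "s - n" "t - n" r] st r by linarith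
      then show ?thesis using 3 Pi Pj Pl st by (simp add: ccw_rotate)
    qed
  qed
  moreover have "P ` {..<n} = S"
    using R(1) by (auto simp: P_def)
  moreover have "P (i + n) = P i" for i by (simp add: P_def)
  ultimately show ?thesis using that by blast
qed

section \<open>Ladders of chords\<close>

text \<open>A walk on which the values increase strictly stays in the upward closed set \<open>T\<close> and uses up
  one element of \<open>T\<close> per visited cell, so it is blocked before its \<open>k\<close>-th step.\<close>

lemma increasing_walk_blocked:
  fixes f :: "nat \<Rightarrow> nat \<Rightarrow> real"
  assumes T: "finite T" "card T \<le> k" and start: "f 0 0 \<in> T"
    and up: "\<And>x i j. x \<in> T \<Longrightarrow> i + j \<le> k \<Longrightarrow> x < f i j \<Longrightarrow> f i j \<in> T"
  obtains i j where "i + j < k" "f (Suc i) j \<le> f i j" "f i (Suc j) \<le> f i j"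
proof (rule ccontr)
  assume blocked: "\<not> thesis"
  have move: "f i j < f (Suc i) j \<or> f i j < f i (Suc j)" if "i + j < k" for i j
    using \<open>i + j < k\<close> blocked \<open>\<And>i j. i + j < k \<Longrightarrow> f (Suc i) j \<le> f i j \<Longrightarrow> f i (Suc j) \<le> f i j \<Longrightarrow> thesis\<close>
    by (meson not_less)
  have "\<exists>i j. i + j = t \<and> f i j \<in> T \<and> t < card {x \<in> T. x \<le> f i j}" if "t \<le> k" for t
    using that
  proof (induction t)
    case 0
    have "{x \<in> T. x \<le> f 0 0} \<noteq> {}" using start by auto
    then show ?case using start T(1) by (auto simp: card_gt_0_iff)
  next
    case (Suc t)
    then obtain i j where ij: "i + j = t" "f i j \<in> T" "t < card {x \<in> T. x \<le> f i j}" by auto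
    then obtain i' j' where ij': "i' + j' = Suc t" "f i j < f i' j'"
      using move[of i j] Suc.prems
      by (metis Suc_le_lessD add_Suc add_Suc_right)
    have "f i' j' \<in> T" using up[OF ij(2) _ ij'(2)] ij'(1) Suc.prems by simp
    moreover from this have "{x \<in> T. x \<le> f i j} \<subset> {x \<in> T. x \<le> f i' j'}"
      using ij'(2) by (intro psubsetI) (auto simp: set_eq_iff intro: order_trans less_imp_le dest: leD)
    then have "card {x \<in> T. x \<le> f i j} < card {x \<in> T. x \<le> f i' j'}"
      using T(1) by (intro psubset_card_mono) auto
    ultimately show ?case using ij(3) ij'(1) by (intro exI[of _ i'] exI[of _ j']) auto
  qed
  then obtain i j where "k < card {x \<in> T. x \<le> f i j}" by blast
  moreover have "card {x \<in> T. x \<le> f i j} \<le> card T" using T(1) by (intro card_mono) auto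
  ultimately show False using T(2) by linarith
qed

text \<open>The four hypotheses on distances say that neither of the chords \<open>i j\<close> and \<open>i' j'\<close> becomes
  longer if one of its ends moves towards the other chord, to \<open>u\<close> or \<open>v\<close> and to \<open>u'\<close> or \<open>v'\<close>. This gives an acute angle at each of
  the four ends; the corners of the quadrilateral \<open>i' i j j'\<close> lie inside these angles.\<close>

lemma facing_blocked_chords_impossible:
  fixes P :: "nat \<Rightarrow> real^2"
  assumes ccwP: "\<And>i j l. i < j \<Longrightarrow> j < l \<Longrightarrow> l < i + n \<Longrightarrow> ccw (P i) (P j) (P l)"
    and order: "i' < u'" "u' \<le> i" "i' \<le> u" "u < i" "i < j" "j < v" "v \<le> j'" "j \<le> v'" "v' < j'"
      "j' < i' + n"
    and blocked: "dist (P u) (P j) \<le> dist (P i) (P j)" "dist (P v) (P i) \<le> dist (P j) (P i)"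
    and blocked': "dist (P u') (P j') \<le> dist (P i') (P j')"
      "dist (P v') (P i') \<le> dist (P j') (P i')"
  shows False
proof -
  have cr: "cross2 (P b - P a) (P c - P a) > 0" "cross2 (P c - P b) (P a - P b) > 0"
    "cross2 (P a - P c) (P b - P c) > 0"
    if "a < b" "b < c" "c < a + n" for a b c
    using ccwP[OF that] ccw_rotate[OF ccwP[OF that]] ccw_rotate[OF ccw_rotate[OF ccwP[OF that]]]
    by (simp_all add: ccw_def)
  have neq: "P a \<noteq> P b" "P b \<noteq> P c" if "a < b" "b < c" "c < a + n" for a b c
    using ccw_imp_distinct[OF ccwP[OF that]] by blast+
  have anti: "cross2 v w = - cross2 w v" for v w by (simp add: cross2_def)
  have between: "u \<bullet> v > 0"
    if "cross2 v u > 0" "cross2 v w > 0" "u = w \<or> cross2 u w > 0" "w \<bullet> v > 0" for u v w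
  proof (rule acute_if_between)
    show "cross2 u w * cross2 v w \<ge> 0"
      using that anti[of w w] by (cases "u = w") auto
  qed (use that in auto)
  have between': "u \<bullet> v > 0"
    if "cross2 u v > 0" "cross2 w v > 0" "u = w \<or> cross2 w u > 0" "w \<bullet> v > 0" for u v w
  proof (rule acute_if_between)
    show "cross2 v u * cross2 v w > 0"
      using that anti[of v u] anti[of v w] by simp
    show "cross2 u w * cross2 v w \<ge> 0"
      using that anti[of v w] anti[of u w] by (cases "u = w") (auto simp: mult_nonpos_nonpos)
  qed (use that in auto)
  have at_i: "(P i' - P i) \<bullet> (P j - P i) > 0"
  proof (rule between)
    show "P i' - P i = P u - P i \<or> cross2 (P i' - P i) (P u - P i) > 0"
      using cr(3)[of i' u i] order by (cases "i' = u") auto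
    show "(P u - P i) \<bullet> (P j - P i) > 0"
      using acute_if_opposite_side_le[OF blocked(1)] neq[of u i j] order by auto
  qed (use cr(2)[of i' i j] cr(2)[of u i j] order in auto)
  have at_j: "(P j' - P j) \<bullet> (P i - P j) > 0"
  proof (rule between')
    show "P j' - P j = P v - P j \<or> cross2 (P v - P j) (P j' - P j) > 0"
      using cr(1)[of j v j'] order by (cases "v = j'") auto
    show "(P v - P j) \<bullet> (P i - P j) > 0"
      using acute_if_opposite_side_le[OF blocked(2)] neq[of i j v] order by auto
  qed (use cr(2)[of i j j'] cr(2)[of i j v] order in auto)
  have at_i': "(P i - P i') \<bullet> (P j' - P i') > 0"
  proof (rule between')
    show "P i - P i' = P u' - P i' \<or> cross2 (P u' - P i') (P i - P i') > 0"
      using cr(1)[of i' u' i] order by (cases "u' = i") auto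
    show "(P u' - P i') \<bullet> (P j' - P i') > 0"
      using acute_if_opposite_side_le[OF blocked'(1)] neq[of i' u' j'] order by auto
  qed (use cr(1)[of i' i j'] cr(1)[of i' u' j'] order in auto)
  have at_j': "(P j - P j') \<bullet> (P i' - P j') > 0"
  proof (rule between)
    show "P j - P j' = P v' - P j' \<or> cross2 (P j - P j') (P v' - P j') > 0"
      using cr(3)[of j v' j'] order by (cases "v' = j") auto
    show "(P v' - P j') \<bullet> (P i' - P j') > 0"
      using acute_if_opposite_side_le[OF blocked'(2)] neq[of i' v' j'] order by auto
  qed (use cr(3)[of i' j j'] cr(3)[of i' v' j'] order in auto)
  have turn: "cross2 (q - p) (r - q) = cross2 (q - p) (r - p)" for p q r
    by (simp add: cross2_def algebra_simps)
  have dot: "(q - p) \<bullet> (r - q) = - ((p - q) \<bullet> (r - q))" for p q r :: "real^2"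
    by (simp add: inner_real2 algebra_simps)
  show False
  proof (rule no_convex_quadrilateral_with_four_acute_angles)
    show "cross2 (P i - P i') (P j - P i) > 0" "cross2 (P j - P i) (P j' - P j) > 0"
      "cross2 (P j' - P j) (P i' - P j') > 0" "cross2 (P i' - P j') (P i - P i') > 0"
      using cr(1)[of i' i j] cr(1)[of i j j'] cr(2)[of i' j j'] cr(3)[of i' i j'] order
        turn[of "P i" "P i'" "P j"] turn[of "P j" "P i" "P j'"]
        turn[of "P j'" "P j" "P i'"] turn[of "P i'" "P j'" "P i"] by simp_all
    show "(P i - P i') \<bullet> (P j - P i) < 0" "(P j - P i) \<bullet> (P j' - P j) < 0"
      "(P j' - P j) \<bullet> (P i' - P j') < 0" "(P i' - P j') \<bullet> (P i - P i') < 0"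
      unfolding dot using at_i at_j at_i' at_j' by (simp_all add: inner_commute)
  qed
qed

text \<open>With \<open>c = s + n\<close>, the chords \<open>P a P (c - a)\<close> with \<open>s < 2 a < s + n\<close> are those of class \<open>s\<close>,
  each listed once, and all indices involved lie in the open interval from \<open>s / 2\<close> to \<open>s / 2 + n\<close>.
  Sorting the values \<open>a\<close> therefore arranges the chords as a ladder.\<close>

lemma parallel_class_card_le:
  fixes P :: "nat \<Rightarrow> real^2"
  assumes ccwP: "\<And>i j l. i < j \<Longrightarrow> j < l \<Longrightarrow> l < i + n \<Longrightarrow> ccw (P i) (P j) (P l)"
    and T: "finite T" "card T \<le> k" and k: "k \<ge> 1"
    and up: "\<And>x a b. x \<in> T \<Longrightarrow> a < b \<Longrightarrow> b < a + n \<Longrightarrow> x < dist (P a) (P b) \<Longrightarrow> dist (P a) (P b) \<in> T"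
  shows "card {a. 2 * a < c \<and> c < 2 * a + n \<and> dist (P a) (P (c - a)) \<in> T} \<le> 2 * k - 1"
proof (rule ccontr)
  let ?X = "{a. 2 * a < c \<and> c < 2 * a + n \<and> dist (P a) (P (c - a)) \<in> T}"
  assume "\<not> card ?X \<le> 2 * k - 1"
  then have large: "2 * k \<le> card ?X" by linarith
  have fin: "finite ?X" by (rule finite_subset[of _ "{..<c}"]) auto
  define x where "x t = sorted_list_of_set ?X ! t" for t
  define y where "y t = c - x t" for t
  define f where "f i j = dist (P (x i)) (P (y j))" for i j
  have len: "length (sorted_list_of_set ?X) = card ?X" by simp
  have x_in: "x t \<in> ?X" if "t < 2 * k" for t
    using that large len fin nth_mem[of t "sorted_list_of_set ?X"] unfolding x_def by simp
  have x_less: "x s < x t" if "s < t" "t < 2 * k" for s t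
    unfolding x_def using that large len
    by (intro sorted_wrt_nth_less[of "(<)"]) simp_all
  have x_le: "x s \<le> x t" if "s \<le> t" "t < 2 * k" for s t
    using x_less[of s t] that by (cases "s = t") auto
  have y_less: "y t < y s" if "s < t" "t < 2 * k" for s t
    using x_less[OF that] x_in[of s] x_in[of t] that unfolding y_def by auto
  have y_le: "y t \<le> y s" if "s \<le> t" "t < 2 * k" for s t
    using x_le[OF that] unfolding y_def by auto
  have window: "x s < y t" "y t < x s + n" if "s < 2 * k" "t < 2 * k" for s t
    using x_in[OF that(1)] x_in[OF that(2)] unfolding y_def by auto
  have rung: "f t t \<in> T" if "t < 2 * k" for t
    using x_in[OF that] unfolding f_def y_def by simp
  have up_f: "f i j \<in> T" if "z \<in> T" "z < f i j" "i < 2 * k" "j < 2 * k" for z i j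
    using up[OF that(1) window[OF that(3,4)]] that(2) unfolding f_def by simp
  obtain i' j' where forward: "i' + j' < k" "f (Suc i') j' \<le> f i' j'" "f i' (Suc j') \<le> f i' j'"
  proof (rule increasing_walk_blocked[of T k f])
    show "f 0 0 \<in> T" using rung k by simp
    show "f i j \<in> T" if "z \<in> T" "i + j \<le> k" "z < f i j" for z i j
      using up_f[OF that(1,3)] that(2) k by simp
  qed (use T in auto)
  obtain i0 j0 where ij0: "i0 + j0 < k"
    "f (2 * k - 1 - Suc i0) (2 * k - 1 - j0) \<le> f (2 * k - 1 - i0) (2 * k - 1 - j0)"
    "f (2 * k - 1 - i0) (2 * k - 1 - Suc j0) \<le> f (2 * k - 1 - i0) (2 * k - 1 - j0)"
  proof (rule increasing_walk_blocked[of T k "\<lambda>i j. f (2 * k - 1 - i) (2 * k - 1 - j)"])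
    show "f (2 * k - 1 - 0) (2 * k - 1 - 0) \<in> T" using rung k by simp
    show "f (2 * k - 1 - i) (2 * k - 1 - j) \<in> T"
      if "z \<in> T" "z < f (2 * k - 1 - i) (2 * k - 1 - j)" for z i j
      using up_f[OF that] k by simp
  qed (use T in auto)
  define i j where "i = 2 * k - 1 - i0" and "j = 2 * k - 1 - j0"
  have backward: "f (i - 1) j \<le> f i j" "f i (j - 1) \<le> f i j"
    using ij0(2,3) by (simp_all add: i_def j_def)
  have ij: "i' < k" "j' < k" "k \<le> i" "k \<le> j" "i < 2 * k" "j < 2 * k"
    using forward(1) ij0(1) unfolding i_def j_def by auto
  show False
  proof (rule facing_blocked_chords_impossible[OF ccwP])
    show "x i' < x (Suc i')" "x (Suc i') \<le> x i" "x i' \<le> x (i - 1)" "x (i - 1) < x i"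
      using ij by (auto intro!: x_less x_le)
    show "y j < y (j - 1)" "y (j - 1) \<le> y j'" "y j \<le> y (Suc j')" "y (Suc j') < y j'"
      using ij by (auto intro!: y_less y_le)
    show "x i < y j" "y j' < x i' + n"
      using ij by (auto intro!: window)
    show "dist (P (x (i - 1))) (P (y j)) \<le> dist (P (x i)) (P (y j))"
      "dist (P (y (j - 1))) (P (x i)) \<le> dist (P (y j)) (P (x i))"
      using backward by (simp_all add: f_def dist_commute)
    show "dist (P (x (Suc i'))) (P (y j')) \<le> dist (P (x i')) (P (y j'))"
      "dist (P (y (Suc j'))) (P (x i')) \<le> dist (P (y j')) (P (x i'))"
      using forward by (simp_all add: f_def dist_commute)
  qed
qed

section \<open>Counting long chords\<close>

lemma finite_distances: "finite S \<Longrightarrow> finite (distances S)"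
proof -
  assume "finite S"
  moreover have "distances S \<subseteq> (\<lambda>(p, q). dist p q) ` (S \<times> S)"
    by (auto simp: distances_def)
  ultimately show ?thesis by (meson finite_SigmaI finite_imageI finite_subset)
qed

text \<open>An upward closed \<open>T\<close> stands for the largest distances. Every chord belongs to exactly one of
  the \<open>n\<close> classes, for which the index sums \<open>c\<close> from \<open>n\<close> to \<open>2 n - 1\<close> are
  representatives.\<close>

theorem card_long_chords_le:
  fixes S :: "(real^2) set"
  assumes conv: "convex_position S"
    and T: "T \<subseteq> distances S" "card T \<le> k" and k: "k \<ge> 1"
    and up: "\<And>x y. x \<in> T \<Longrightarrow> y \<in> distances S \<Longrightarrow> x < y \<Longrightarrow> y \<in> T"
  shows "card (\<Union>x\<in>T. pairs_at_distance S x) \<le> (2 * k - 1) * card S"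
proof -
  define n where "n = card S"
  have finS: "finite S" using conv by (simp add: convex_position_def)
  then have finT: "finite T" using T(1) finite_distances finite_subset by blast
  obtain P where P: "P ` {..<n} = S" and per: "\<And>i. P (i + n) = P i"
    and ccwP: "\<And>i j l. i < j \<Longrightarrow> j < l \<Longrightarrow> l < i + n \<Longrightarrow> ccw (P i) (P j) (P l)"
    using convex_position_cyclic_enumeration[OF conv n_def] by metis
  have inj: "inj_on P {..<n}"
    using P n_def finS by (metis card_lessThan eq_card_imp_inj_on finite_lessThan)
  have mod: "P i = P (i mod n)" for i
  proof -
    have "P (m + q * n) = P m" for m q
      by (induction q) (simp_all add: per add.assoc[symmetric] add.commute[of n])
    then show ?thesis by (metis mod_div_mult_eq)
  qed
  have P_in: "P i \<in> S" if "n > 0" for i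
    using that P mod[of i] by (metis imageI lessThan_iff mod_less_divisor)
  have P_neq: "P a \<noteq> P b" if "a < b" "b < a + n" for a b
  proof
    assume "P a = P b"
    then have "P (a mod n) = P (b mod n)" using mod by metis
    then have "a mod n = b mod n" using inj that by (auto simp: inj_on_def)
    then have "n dvd b - a" using that mod_eq_dvd_iff_nat[of a b n] by simp
    then show False using that by (auto dest: dvd_imp_le)
  qed
  define X where "X c = {a. 2 * a < c \<and> c < 2 * a + n \<and> dist (P a) (P (c - a)) \<in> T}" for c
  have card_X: "card (X c) \<le> 2 * k - 1" for c
    unfolding X_def
  proof (rule parallel_class_card_le[OF ccwP finT T(2) k])
    fix x a b assume "x \<in> T" "a < b" "b < a + n" "x < dist (P a) (P b)"
    moreover from this have "dist (P a) (P b) \<in> distances S"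
      using P_neq[of a b] P_in[of a] P_in[of b] unfolding distances_def by auto
    ultimately show "dist (P a) (P b) \<in> T" using up by blast
  qed
  have fin_X: "finite (X c)" for c
    by (rule finite_subset[of _ "{..<c}"]) (auto simp: X_def)
  let ?E = "\<Union>x\<in>T. pairs_at_distance S x"
  have "?E \<subseteq> (\<Union>c\<in>{n..<2 * n}. (\<lambda>a. {P a, P (c - a)}) ` X c)"
  proof
    fix e assume "e \<in> ?E"
    then obtain p q where pq: "e = {p, q}" "p \<in> S" "q \<in> S" "p \<noteq> q" "dist p q \<in> T"
      by (auto simp: pairs_at_distance_def)
    then have "p \<in> P ` {..<n}" "q \<in> P ` {..<n}" by (simp_all add: P)
    then obtain i0 j0 where "i0 < n" "j0 < n" "p = P i0" "q = P j0" by auto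
    moreover from this have "i0 < j0 \<or> j0 < i0" using pq(4) by (cases i0 j0 rule: linorder_cases) auto
    moreover have "e = {q, p}" "dist q p \<in> T" using pq by (auto simp: dist_commute)
    ultimately obtain i j where ij: "i < j" "j < n" "e = {P i, P j}" "dist (P i) (P j) \<in> T"
      using pq(1,5) by auto
    \<comment> \<open>The index of one end is lifted by \<open>n\<close> if needed, so that the sum of both is in the range.\<close>
    show "e \<in> (\<Union>c\<in>{n..<2 * n}. (\<lambda>a. {P a, P (c - a)}) ` X c)"
    proof (cases "i + j < n")
      case True
      have "P (i + j + n - j) = P i" using per[of i] by simp
      moreover from this have "j \<in> X (i + j + n)"
        using ij by (simp add: X_def dist_commute)
      moreover have "i + j + n \<in> {n..<2 * n}" using True by simp
      ultimately have "j \<in> X (i + j + n)" "i + j + n \<in> {n..<2 * n}" "e = {P j, P (i + j + n - j)}"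
        using ij(3) by auto
      then show ?thesis by blast
    next
      case False
      have "i \<in> X (i + j)" "i + j \<in> {n..<2 * n}" "e = {P i, P (i + j - i)}"
        using False ij by (simp_all add: X_def)
      then show ?thesis by blast
    qed
  qed
  then have "card ?E \<le> card (\<Union>c\<in>{n..<2 * n}. (\<lambda>a. {P a, P (c - a)}) ` X c)"
    using fin_X by (intro card_mono) auto
  also have "\<dots> \<le> (\<Sum>c\<in>{n..<2 * n}. card ((\<lambda>a. {P a, P (c - a)}) ` X c))"
    by (rule card_UN_le) simp
  also have "\<dots> \<le> (\<Sum>c\<in>{n..<2 * n}. 2 * k - 1)"
    by (intro sum_mono order_trans[OF card_image_le card_X] fin_X)
  also have "\<dots> = (2 * k - 1) * card S" by (simp add: n_def)
  finally show ?thesis .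
qed

theorem theorem1p3:
  fixes S :: "(real^2) set" and n k :: nat
  assumes "k \<ge> 1"
    and "finite S" and "card S = n"
    and "convex_position S"
  shows "(\<Sum>i=1..k. mult_dist S i) \<le> (2 * k - 1) * n"
proof -
  define N where "N = card (distances S)"
  define T where "T = nth_distance S ` {1..min k N}"
  define ds where "ds = rev (sorted_list_of_set (distances S))"
  have len: "length ds = N" and set_ds: "set ds = distances S" and sorted: "sorted_wrt (>) ds"
    using finite_distances[OF assms(2)] by (simp_all add: ds_def N_def sorted_wrt_rev)
  have nth: "nth_distance S i = ds ! (i - 1)" for i
    by (simp add: nth_distance_def ds_def)
  have anti: "nth_distance S j < nth_distance S i" if "1 \<le> i" "i < j" "j \<le> N" for i j
    using sorted_wrt_nth_less[OF sorted, of "i - 1" "j - 1"] that len by (auto simp: nth)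
  have inj: "inj_on (nth_distance S) {1..min k N}"
    by (rule linorder_inj_onI') (use anti in fastforce)
  have T_sub: "T \<subseteq> distances S"
    by (auto simp: T_def nth len simp flip: set_ds)
  have "card T \<le> k"
    using card_image_le[of "{1..min k N}" "nth_distance S"] by (simp add: T_def)
  moreover have "y \<in> T" if "x \<in> T" "y \<in> distances S" "x < y" for x y
  proof -
    obtain i where i: "1 \<le> i" "i \<le> min k N" "x = nth_distance S i"
      using \<open>x \<in> T\<close> by (auto simp: T_def)
    obtain t where t: "t < N" "y = ds ! t"
      using \<open>y \<in> distances S\<close> set_ds len by (metis in_set_conv_nth)
    then have "y = nth_distance S (Suc t)" by (simp add: nth)
    moreover from this have "Suc t \<le> i"
      using anti[of i "Suc t"] i t \<open>x < y\<close> by fastforce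
    ultimately show ?thesis using i by (auto simp: T_def)
  qed
  ultimately have bound: "card (\<Union>x\<in>T. pairs_at_distance S x) \<le> (2 * k - 1) * card S"
    using card_long_chords_le[OF assms(4) T_sub] assms(1) by blast
  have fin_pairs: "finite (pairs_at_distance S x)" for x
    by (rule finite_subset[of _ "Pow S"]) (auto simp: pairs_at_distance_def assms(2))
  have disj: "pairs_at_distance S x \<inter> pairs_at_distance S y = {}" if "x \<noteq> y" for x y
    using that by (auto simp: pairs_at_distance_def doubleton_eq_iff dist_commute)
  have "(\<Sum>i=1..k. mult_dist S i)
      = (\<Sum>i\<in>{1..min k N}. card (pairs_at_distance S (nth_distance S i)))"
    by (rule sum.mono_neutral_cong_right) (auto simp: mult_dist_def N_def)
  also have "\<dots> = (\<Sum>x\<in>T. card (pairs_at_distance S x))"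
    unfolding T_def sum.reindex[OF inj] by simp
  also have "\<dots> = card (\<Union>x\<in>T. pairs_at_distance S x)"
    using fin_pairs disj by (intro card_UN_disjoint[symmetric]) (auto simp: T_def)
  finally show ?thesis using bound assms(3) by simp
qed

end
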